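(* Let $m\ge 1$ be an integer, let $K$ be an edge-path connected simplicial complex and $v_0$ a vertex of $K$. Let $\mathrm{id}:K\to K$ be the identity map and $c_{v_0}:K\to K$ the constant map at $v_0$. Then $\mathrm{scat}_m(K)=\mathrm{SD}_m(\mathrm{id},c_{v_0})$.
   Context: Simplicial complexes are abstract simplicial complexes. Simplicial maps $f,g:A\to B$ are contiguous, $f\sim_c g$, if for every simplex $\{v_0,\dots,v_k\}$ of $A$ the set $\{f(v_0),\dots,f(v_k),g(v_0),\dots,g(v_k)\}$ is a simplex of $B$. They are in the same contiguity class, $f\sim g$, if there is a finite sequence of simplicial maps $f=f_0\sim_c f_1\sim_c\dots\sim_c f_n=g$ from $A$ to $B$. For simplicial maps $\varphi,\psi:A\to B$, the $m$-contiguity distance $\mathrm{SD}_m(\varphi,\psi)$ is the least integer $k\ge 0$ such that $A$ is covered by subcomplexes $A_0,\dots,A_k$ with the property that for each $j$ and every simplicial map $\eta:P\to A_j$ from an $m$-dimensional simplicial complex $P$, $\varphi\circ\eta\sim\psi\circ\eta$ ($\infty$ if no such cover exists). For $m\ge 1$, the $m$-simplicial LS category $\mathrm{scat}_m(K)$ is the least integer $k\ge 0$ such that $K$ is covered by subcomplexes $K_0,\dots,K_k$ with the property that for each $j$ and every simplicial map $\eta:P\to K_j$ from an $m$-dimensional simplicial complex $P$, $\iota_j\circ\eta\sim c_{v_0}\circ\eta$, where $\iota_j:K_j\to K$ is the inclusion and $c_{v_0}:K_j\to K$ is the constant map at a vertex $v_0$ of $K$ ($\infty$ if no such cover exists). 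*)

theory Defs
  imports Main "HOL-Library.Extended_Nat"
begin

text \<open>
  A complex is the set of its simplices; the empty set is not counted as a simplex.
  Simplicial maps are total functions on the vertex type, of which only the values on vertices
  matter: two simplicial maps that agree on the vertices of \<open>A\<close> are contiguous.
\<close>

definition abstract_complex :: "'v set set \<Rightarrow> bool" where
  "abstract_complex K \<longleftrightarrow>
     (\<forall>\<sigma>\<in>K. finite \<sigma> \<and> \<sigma> \<noteq> {}) \<and> (\<forall>\<sigma>\<in>K. \<forall>\<tau>. \<tau> \<subseteq> \<sigma> \<and> \<tau> \<noteq> {} \<longrightarrow> \<tau> \<in> K)"

definition subcomplex :: "'v set set \<Rightarrow> 'v set set \<Rightarrow> bool" where
  "subcomplex L K \<longleftrightarrow> abstract_complex L \<and> L \<subseteq> K"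

definition vertices :: "'v set set \<Rightarrow> 'v set" where
  "vertices K = \<Union>K"

definition has_dimension :: "'v set set \<Rightarrow> nat \<Rightarrow> bool" where
  "has_dimension K m \<longleftrightarrow> (\<exists>\<sigma>\<in>K. card \<sigma> = m + 1) \<and> (\<forall>\<sigma>\<in>K. card \<sigma> \<le> m + 1)"

definition edge_path_connected :: "'v set set \<Rightarrow> bool" where
  "edge_path_connected K \<longleftrightarrow>
     (\<forall>u\<in>vertices K. \<forall>v\<in>vertices K. (\<lambda>x y. {x, y} \<in> K)\<^sup>*\<^sup>* u v)"

definition simplicial_map :: "'a set set \<Rightarrow> 'b set set \<Rightarrow> ('a \<Rightarrow> 'b) \<Rightarrow> bool" where
  "simplicial_map A B f \<longleftrightarrow> (\<forall>\<sigma>\<in>A. f ` \<sigma> \<in> B)"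

definition contiguous :: "'a set set \<Rightarrow> 'b set set \<Rightarrow> ('a \<Rightarrow> 'b) \<Rightarrow> ('a \<Rightarrow> 'b) \<Rightarrow> bool" where
  "contiguous A B f g \<longleftrightarrow>
     simplicial_map A B f \<and> simplicial_map A B g \<and> (\<forall>\<sigma>\<in>A. f ` \<sigma> \<union> g ` \<sigma> \<in> B)"

definition same_contiguity_class ::
    "'a set set \<Rightarrow> 'b set set \<Rightarrow> ('a \<Rightarrow> 'b) \<Rightarrow> ('a \<Rightarrow> 'b) \<Rightarrow> bool" where
  "same_contiguity_class A B f g \<longleftrightarrow>
     simplicial_map A B f \<and> simplicial_map A B g \<and> (contiguous A B)\<^sup>*\<^sup>* f g"

text \<open>
  The condition imposed on each member \<open>L\<close> of a cover. A definition cannot quantify over the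
  vertex type of \<open>P\<close>, so \<open>P\<close> ranges over the complexes on the type \<open>'a + nat\<close>. This loses nothing:
  lemma \<open>m_contiguous_on_any_vertex_type\<close> below extends the condition to \<open>P\<close> on any vertex type.
\<close>

definition m_contiguous_on ::
    "nat \<Rightarrow> 'a set set \<Rightarrow> 'b set set \<Rightarrow> ('a \<Rightarrow> 'b) \<Rightarrow> ('a \<Rightarrow> 'b) \<Rightarrow> bool" where
  "m_contiguous_on m L B \<phi> \<psi> \<longleftrightarrow>
     (\<forall>(P :: ('a + nat) set set) \<eta>.
        abstract_complex P \<and> has_dimension P m \<and> simplicial_map P L \<eta> \<longrightarrow>
        same_contiguity_class P B (\<phi> \<circ> \<eta>) (\<psi> \<circ> \<eta>))"

definition subcomplex_cover :: "'v set set \<Rightarrow> nat \<Rightarrow> (nat \<Rightarrow> 'v set set) \<Rightarrow> bool" where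
  "subcomplex_cover K k L \<longleftrightarrow> (\<forall>j\<le>k. subcomplex (L j) K) \<and> (\<Union>j\<le>k. L j) = K"

text \<open>In \<open>enat\<close> the infimum of the empty set is \<open>\<infinity>\<close>.\<close>

definition SD ::
    "nat \<Rightarrow> 'a set set \<Rightarrow> 'b set set \<Rightarrow> ('a \<Rightarrow> 'b) \<Rightarrow> ('a \<Rightarrow> 'b) \<Rightarrow> enat" where
  "SD m A B \<phi> \<psi> =
     Inf {enat k | k. \<exists>L. subcomplex_cover A k L \<and> (\<forall>j\<le>k. m_contiguous_on m (L j) B \<phi> \<psi>)}"

text \<open>
  No base vertex is part of the data of \<open>scat\<close>: each member of the cover may use its own
  vertex \<open>v\<close> of \<open>K\<close>. The inclusion of \<open>L j\<close> into \<open>K\<close> is represented by \<open>id\<close>.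
\<close>

definition scat :: "nat \<Rightarrow> 'v set set \<Rightarrow> enat" where
  "scat m K =
     Inf {enat k | k. \<exists>L. subcomplex_cover K k L \<and>
       (\<forall>j\<le>k. \<exists>v\<in>vertices K. m_contiguous_on m (L j) K id (\<lambda>_. v))}"

lemma simplicial_map_comp:
  "simplicial_map A B f \<Longrightarrow> simplicial_map B C g \<Longrightarrow> simplicial_map A C (g \<circ> f)"
  unfolding simplicial_map_def by (metis image_comp)

lemma contiguous_comp_right:
  assumes "simplicial_map Q P \<theta>" "contiguous P B f g"
  shows "contiguous Q B (f \<circ> \<theta>) (g \<circ> \<theta>)"
proof -
  have "(f \<circ> \<theta>) ` \<sigma> \<union> (g \<circ> \<theta>) ` \<sigma> \<in> B" if "\<sigma> \<in> Q" for \<sigma>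
    using assms that unfolding contiguous_def simplicial_map_def by (metis image_comp)
  then show ?thesis
    using assms unfolding contiguous_def by (blast intro: simplicial_map_comp)
qed

lemma same_contiguity_class_comp_right:
  assumes "simplicial_map Q P \<theta>" "same_contiguity_class P B f g"
  shows "same_contiguity_class Q B (f \<circ> \<theta>) (g \<circ> \<theta>)"
proof -
  have "(contiguous P B)\<^sup>*\<^sup>* f g"
    using assms(2) by (simp add: same_contiguity_class_def)
  then have "(contiguous Q B)\<^sup>*\<^sup>* (f \<circ> \<theta>) (g \<circ> \<theta>)"
    by induction (blast intro: rtranclp.rtrancl_into_rtrancl contiguous_comp_right [OF assms(1)])+
  then show ?thesis
    using assms by (auto simp: same_contiguity_class_def intro: simplicial_map_comp)
qed

text \<open>
  Every map from an \<open>m\<close>-dimensional complex to \<open>L\<close> factors through the \<open>m\<close>-skeleton of \<open>L\<close>. A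
  disjoint \<open>m\<close>-simplex, mapped to a single vertex, makes the dimension exactly \<open>m\<close>.
\<close>

lemma m_contiguous_on_any_vertex_type:
  fixes L :: "'a set set" and Q :: "'p set set"
  assumes L: "abstract_complex L"
    and mc: "m_contiguous_on m L B \<phi> \<psi>"
    and Q: "abstract_complex Q" "has_dimension Q m"
    and \<eta>: "simplicial_map Q L \<eta>"
  shows "same_contiguity_class Q B (\<phi> \<circ> \<eta>) (\<psi> \<circ> \<eta>)"
proof -
  obtain q \<sigma>0 where q: "\<sigma>0 \<in> Q" "q \<in> \<sigma>0"
    using Q by (fastforce simp: has_dimension_def abstract_complex_def)
  then have "\<eta> ` \<sigma>0 \<in> L" "{\<eta> q} \<subseteq> \<eta> ` \<sigma>0"
    using \<eta> by (auto simp: simplicial_map_def)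
  then have w: "{\<eta> q} \<in> L"
    using L unfolding abstract_complex_def by blast
  define S where "S = {\<sigma> \<in> L. card \<sigma> \<le> m + 1}"
  define D where "D = {\<tau> :: nat set. \<tau> \<noteq> {} \<and> \<tau> \<subseteq> {..m}}"
  define P :: "('a + nat) set set" where "P = (\<lambda>\<sigma>. Inl ` \<sigma>) ` S \<union> (\<lambda>\<tau>. Inr ` \<tau>) ` D"
  define \<rho> :: "'a + nat \<Rightarrow> 'a" where "\<rho> = case_sum id (\<lambda>_. \<eta> q)"
  have S: "abstract_complex S"
    using L unfolding S_def abstract_complex_def
    by (auto intro: order_trans [OF card_mono])
  have finD: "finite \<tau>" if "\<tau> \<in> D" for \<tau>
    using that by (auto simp: D_def intro: finite_subset)
  have cardD: "card \<tau> \<le> m + 1" if "\<tau> \<in> D" for \<tau>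
    using that card_mono [of "{..m}" \<tau>] by (auto simp: D_def)
  have "abstract_complex P"
    unfolding abstract_complex_def
  proof (intro conjI ballI allI impI)
    fix \<sigma> assume "\<sigma> \<in> P"
    then show "finite \<sigma>" "\<sigma> \<noteq> {}"
      using S finD by (auto simp: P_def abstract_complex_def) (auto simp: D_def)
  next
    fix \<sigma> \<tau> assume "\<sigma> \<in> P" and \<tau>: "\<tau> \<subseteq> \<sigma> \<and> \<tau> \<noteq> {}"
    then consider s where "s \<in> S" "\<sigma> = Inl ` s" | s where "s \<in> D" "\<sigma> = Inr ` s"
      by (auto simp: P_def)
    then show "\<tau> \<in> P"
    proof cases
      case 1
      then obtain t where "t \<subseteq> s" "\<tau> = Inl ` t"
        using \<tau> by (meson subset_imageE)
      moreover from this have "t \<in> S"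
        using 1 S \<tau> unfolding abstract_complex_def by blast
      ultimately show ?thesis by (auto simp: P_def)
    next
      case 2
      then obtain t where "t \<subseteq> s" "\<tau> = Inr ` t"
        using \<tau> by (meson subset_imageE)
      moreover from this have "t \<in> D"
        using 2 \<tau> unfolding D_def by blast
      ultimately show ?thesis by (auto simp: P_def)
    qed
  qed
  moreover have "has_dimension P m"
    unfolding has_dimension_def
  proof
    have "{..m} \<in> D"
      by (auto simp: D_def)
    then have "Inr ` {..m} \<in> P"
      by (auto simp: P_def)
    moreover have "card (Inr ` {..m} :: ('a + nat) set) = m + 1"
      by (simp add: card_image)
    ultimately show "\<exists>\<sigma>\<in>P. card \<sigma> = m + 1" by blast
    show "\<forall>\<sigma>\<in>P. card \<sigma> \<le> m + 1"
      using cardD by (auto simp: P_def S_def card_image)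
  qed
  moreover have "simplicial_map P L \<rho>"
    unfolding simplicial_map_def
  proof
    fix \<sigma> assume "\<sigma> \<in> P"
    then consider s where "s \<in> S" "\<sigma> = Inl ` s" | s where "s \<in> D" "\<sigma> = Inr ` s"
      by (auto simp: P_def)
    then show "\<rho> ` \<sigma> \<in> L"
    proof cases
      case 1
      then have "\<rho> ` \<sigma> = s"
        by (simp add: \<rho>_def image_image)
      then show ?thesis
        using 1 by (simp add: S_def)
    next
      case 2
      then have "\<rho> ` \<sigma> = {\<eta> q}"
        by (auto simp: \<rho>_def D_def image_image)
      then show ?thesis
        using w by simp
    qed
  qed
  ultimately have "same_contiguity_class P B (\<phi> \<circ> \<rho>) (\<psi> \<circ> \<rho>)"
    using mc unfolding m_contiguous_on_def by blast
  moreover have "simplicial_map Q P (Inl \<circ> \<eta>)"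
    unfolding simplicial_map_def
  proof
    fix \<sigma> assume \<sigma>: "\<sigma> \<in> Q"
    then have "finite \<sigma>"
      using Q(1) unfolding abstract_complex_def by blast
    then have "card (\<eta> ` \<sigma>) \<le> card \<sigma>"
      by (rule card_image_le)
    moreover have "card \<sigma> \<le> m + 1"
      using \<sigma> Q(2) unfolding has_dimension_def by blast
    moreover have "\<eta> ` \<sigma> \<in> L"
      using \<eta> \<sigma> by (simp add: simplicial_map_def)
    ultimately have "\<eta> ` \<sigma> \<in> S"
      by (simp add: S_def)
    then have "Inl ` \<eta> ` \<sigma> \<in> P"
      unfolding P_def by blast
    then show "(Inl \<circ> \<eta>) ` \<sigma> \<in> P"
      by (simp only: image_comp)
  qed
  ultimately have "same_contiguity_class Q B (\<phi> \<circ> \<rho> \<circ> (Inl \<circ> \<eta>)) (\<psi> \<circ> \<rho> \<circ> (Inl \<circ> \<eta>))"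
    by (rule same_contiguity_class_comp_right [rotated])
  moreover have "\<rho> \<circ> (Inl \<circ> \<eta>) = \<eta>"
    by (auto simp: \<rho>_def)
  ultimately show ?thesis
    by (simp add: comp_assoc)
qed

end

theory Submission imports Defs begin

text \<open>
  Along an edge path from \<open>v\<close> to \<open>v0\<close>, constant maps at adjacent vertices are contiguous. So the
  constant maps at \<open>v\<close> and \<open>v0\<close> are in the same contiguity class, and the base vertices of the
  members of a cover may all be replaced by \<open>v0\<close>.
\<close>

lemma same_contiguity_class_trans:
  assumes "same_contiguity_class A B f g" "same_contiguity_class A B g h"
  shows "same_contiguity_class A B f h"
  using assms unfolding same_contiguity_class_def by (meson rtranclp_trans)

text \<open>Simplices of \<open>P\<close> are nonempty, so the two images of any simplex are exactly
  \<open>{u}\<close> and \<open>{v}\<close>, with union the given edge; both are faces of it. The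
  case \<open>u = v\<close> is allowed and is used below.\<close>

lemma contiguous_const:
  fixes K :: "'b set set"
  assumes P: "abstract_complex P" and K: "abstract_complex K" and uv: "{u, v} \<in> K"
  shows "contiguous P K (\<lambda>_. u) (\<lambda>_. v)"
proof -
  have "\<tau> \<in> K" if "\<tau> \<subseteq> {u, v}" "\<tau> \<noteq> {}" for \<tau>
    using K uv that unfolding abstract_complex_def by metis
  then have "{u} \<in> K" "{v} \<in> K"
    by simp_all
  moreover have "(\<lambda>_. w) ` \<sigma> = {w}" if "\<sigma> \<in> P" for w :: 'b and \<sigma>
    using P that by (auto simp: abstract_complex_def)
  ultimately show ?thesis
    using uv by (simp add: contiguous_def simplicial_map_def insert_commute)
qed

lemma same_contiguity_class_const:
  assumes P: "abstract_complex P" and K: "abstract_complex K" "edge_path_connected K"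
    and uv: "u \<in> vertices K" "v \<in> vertices K"
  shows "same_contiguity_class P K (\<lambda>_. u) (\<lambda>_. v)"
proof -
  have "(\<lambda>x y. {x, y} \<in> K)\<^sup>*\<^sup>* u v"
    using K(2) uv unfolding edge_path_connected_def by blast
  then have "(contiguous P K)\<^sup>*\<^sup>* (\<lambda>_. u) (\<lambda>_. v)"
  proof induction
    case (step y z)
    then show ?case
      using contiguous_const [OF P K(1) step.hyps(2)] by (meson rtranclp.rtrancl_into_rtrancl)
  qed simp
  \<comment> \<open>The path may have length zero, so the chain of contiguities alone does not show
    that its ends are simplicial.\<close>
  moreover have "simplicial_map P K (\<lambda>_. w)" if w: "w \<in> vertices K" for w
  proof -
    obtain \<sigma> where "\<sigma> \<in> K" "{w, w} \<subseteq> \<sigma>"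
      using w by (auto simp: vertices_def)
    \<comment> \<open>The vertex is viewed as a degenerate edge, so that a constant map is
      contiguous to itself.\<close>
    then have "{w, w} \<in> K"
      using K(1) unfolding abstract_complex_def by blast
    from contiguous_const [OF P K(1) this] show ?thesis
      by (simp add: contiguous_def)
  qed
  ultimately show ?thesis
    using uv by (simp add: same_contiguity_class_def)
qed

text \<open>A constant map precomposed with any \<open>\<eta>\<close> is the same constant on
  \<open>P\<close>, so the two constants are compared on \<open>P\<close> itself, independently of
  \<open>\<eta>\<close> and \<open>L\<close>.\<close>

lemma m_contiguous_on_const_vertex:
  assumes "abstract_complex K" "edge_path_connected K" "u \<in> vertices K" "v \<in> vertices K"
    and "m_contiguous_on m (L :: 'a set set) K \<phi> (\<lambda>_. u)"
  shows "m_contiguous_on m L K \<phi> (\<lambda>_. v)"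
  unfolding m_contiguous_on_def
proof (intro allI impI)
  fix P :: "('a + nat) set set" and \<eta>
  assume P: "abstract_complex P \<and> has_dimension P m \<and> simplicial_map P L \<eta>"
  then have "same_contiguity_class P K (\<phi> \<circ> \<eta>) (\<lambda>_. u)"
    using assms(5) unfolding m_contiguous_on_def comp_def by blast
  moreover have "same_contiguity_class P K (\<lambda>_. u) (\<lambda>_. v)"
    using P assms(1-4) by (simp add: same_contiguity_class_const)
  ultimately show "same_contiguity_class P K (\<phi> \<circ> \<eta>) ((\<lambda>_. v) \<circ> \<eta>)"
    unfolding comp_def by (rule same_contiguity_class_trans)
qed

theorem theorem3p4:
  fixes m :: nat and K :: "'v set set" and v0 :: 'v
  assumes "m \<ge> 1"
    and "abstract_complex K"
    and "edge_path_connected K"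
    and "v0 \<in> vertices K"
  shows "scat m K = SD m K K id (\<lambda>_. v0)"
proof -
  \<comment> \<open>From right to left the witness is \<open>v0\<close> itself. As this holds for
    each \<open>L\<close> separately, the same covers are admissible for both infima.\<close>
  have "(\<exists>v\<in>vertices K. m_contiguous_on m L K id (\<lambda>_. v)) \<longleftrightarrow> m_contiguous_on m L K id (\<lambda>_. v0)"
    for L
    using m_contiguous_on_const_vertex [OF assms(2,3) _ assms(4)] assms(4) by blast
  then show ?thesis
    by (simp add: scat_def SD_def)
qed

end
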